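(* Let $k\ge 1$ and $n\ge 1$ be integers and let $\mathcal{M}=([n],\{\chi,-\chi\})$ be a degree-$k$ uniform oriented matroid on the ground set $[n]=\{1,\dots,n\}$ (with its usual order). Then there exists a $k$-intersecting pseudoconfiguration of points $PP=(P,L)$ in general position, with $P=\{p_1,\dots,p_n\}$ and $x(p_1)<\cdots<x(p_n)$, such that $\mathcal{M}=\mathcal{M}_{PP}$, i.e. $\{\chi,-\chi\}=\{\chi_{PP},-\chi_{PP}\}$.
   Context: **Notation.** For a finite ordered set $S$ and a positive integer $r$, $\Lambda(S,r)=\{(\lambda_1,\dots,\lambda_r)\in S^r : \lambda_1<\cdots<\lambda_r\}$. For $\lambda\in\Lambda(S,r)$, $\bar\lambda=\{\lambda_1,\dots,\lambda_r\}$, and $\lambda\setminus\{\lambda_i\}$ is $\lambda$ with the entry $\lambda_i$ deleted. $x(p)$ is the $x$-coordinate of a point $p\in\mathbb{R}^2$. **Oriented matroids.** For a finite set $E$, a map $\chi:E^r\to\{+1,-1,0\}$ is a chirotope of rank $r$ if (B1) $\chi$ is not identically zero; (B2) $\chi(i_{\sigma(1)},\dots,i_{\sigma(r)})=\mathrm{sgn}(\sigma)\chi(i_1,\dots,i_r)$ for all $i_1,\dots,i_r\in E$ and all permutations $\sigma$ of $[r]$; (B3) for all $\lambda,\mu\in E^r$, the set $\{-\chi(\lambda)\chi(\mu)\}\cup\{\chi(\lambda[\lambda_1|\mu_s])\,\chi(\mu[\mu_s|\lambda_1]) : s=1,\dots,r\}$ either contains $\{+1,-1\}$ or equals $\{0\}$,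 where $\lambda[\lambda_i|a]$ is $\lambda$ with its $i$-th entry replaced by $a$. The pair $(E,\{\chi,-\chi\})$ is then an oriented matroid of rank $r$; it is uniform if $\chi(\lambda)\ne 0$ for all $\lambda\in\Lambda(E,r)$ (for some, equivalently any, linear order on $E$). **Degree-$k$ uniform oriented matroids.** Let $E$ be a finite ordered set. A uniform oriented matroid $(E,\{\chi,-\chi\})$ of rank $k+2$ is a degree-$k$ uniform oriented matroid if for every $\lambda\in\Lambda(E,k+3)$ and all $a<b<c$ in $\bar\lambda$, setting $\mu_1=\lambda\setminus\{c\}$, $\mu_2=\lambda\setminus\{b\}$, $\mu_3=\lambda\setminus\{a\}$ (so $\mu_1<\mu_2<\mu_3$ lexicographically), one has: if $\chi(\mu_1)=-\chi(\mu_2)$, then $\chi(\mu_3)=\chi(\mu_2)$. **$k$-intersecting pseudoconfigurations of points.** An $x$-monotone Jordan curve is a set $l=\{(x,f(x)):x\in\mathbb{R}\}$ with $f:\mathbb{R}\to\mathbb{R}$ continuous; put $l^+=\{(x,y):y>f(x)\}$ and $l^-=\{(x,y):y<f(x)\}$. A pair $PP=(P,L)$ of a point set $P=\{p_1,\dots,p_n\}\subset\mathbb{R}^2$ with $x(p_1)<\cdots<x(p_n)$ and a collection $L$ of $x$-monotone Jordan curves is a $k$-intersecting pseudoconfiguration of points if: (PP1) every $l\in L$ contains at least $k+1$ points of $P$; (PP2) for any $k+1$ points of $P$ there is a unique $l\in L$ passing through all of them; (PP3) any two distinct $l_1,l_2\in L$ intersect at most $k$ times, each intersection being transversal (at each common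 point the two curves exchange their above-below order). It is in general position if $|P\cap l|=k+1$ for all $l\in L$; then $l_{i_1,\dots,i_{k+1}}$ denotes the curve of $L$ through $p_{i_1},\dots,p_{i_{k+1}}$. **The map $\chi_{PP}$.** For $PP$ in general position, $\chi_{PP}:[n]^{k+2}\to\{+1,-1,0\}$ is the (well-defined) map such that: for $\lambda_1<\cdots<\lambda_{k+1}$ and $\lambda_{k+2}\notin\{\lambda_1,\dots,\lambda_{k+1}\}$, $\chi_{PP}(\lambda_1,\dots,\lambda_{k+2})=+1$ if $p_{\lambda_{k+2}}\in l^+_{\lambda_1,\dots,\lambda_{k+1}}$ and $-1$ if $p_{\lambda_{k+2}}\in l^-_{\lambda_1,\dots,\lambda_{k+1}}$; $\chi_{PP}$ is $0$ on tuples with a repeated entry; and $\chi_{PP}(\lambda_{\sigma(1)},\dots,\lambda_{\sigma(k+2)})=\mathrm{sgn}(\sigma)\chi_{PP}(\lambda_1,\dots,\lambda_{k+2})$ for every permutation $\sigma$ of $[k+2]$. $\mathcal{M}_{PP}$ denotes $([n],\{\chi_{PP},-\chi_{PP}\})$. *)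

theory Defs
  imports Complex_Main "HOL-Combinatorics.Permutations"
begin

section \<open>Chirotopes and oriented matroids\<close>

text \<open>Elements of $E^r$ are lists of length $r$; positions are therefore counted from 0.\<close>

definition tuples :: "'a set \<Rightarrow> nat \<Rightarrow> 'a list set" where
  "tuples E r = {xs. length xs = r \<and> set xs \<subseteq> E}"

definition increasing_tuples :: "'a::linorder set \<Rightarrow> nat \<Rightarrow> 'a list set" where
  "increasing_tuples S r = {xs \<in> tuples S r. sorted_wrt (<) xs}"

text \<open>A map on $E^r$ is a total function on lists that takes the dummy value 0 off $E^r$.
  With this convention equality of HOL functions is equality of maps on $E^r$, and
  the convention is stable under negation.\<close>

definition alternating_on :: "'a set \<Rightarrow> nat \<Rightarrow> ('a list \<Rightarrow> int) \<Rightarrow> bool" where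
  "alternating_on E r chi \<longleftrightarrow>
     (\<forall>xs \<in> tuples E r. \<forall>\<sigma>. \<sigma> permutes {..<r} \<longrightarrow>
        chi (permute_list \<sigma> xs) = sign \<sigma> * chi xs)"

definition chirotope :: "'a set \<Rightarrow> nat \<Rightarrow> ('a list \<Rightarrow> int) \<Rightarrow> bool" where
  "chirotope E r chi \<longleftrightarrow>
     finite E \<and>
     (\<forall>xs \<in> tuples E r. chi xs \<in> {1, -1, 0}) \<and>
     (\<forall>xs. xs \<notin> tuples E r \<longrightarrow> chi xs = 0) \<and>
     (\<exists>xs \<in> tuples E r. chi xs \<noteq> 0) \<and>
     alternating_on E r chi \<and>
     (\<forall>xs \<in> tuples E r. \<forall>ys \<in> tuples E r.
        let A = {- (chi xs * chi ys)} \<union> {chi (xs[0 := ys ! s]) * chi (ys[s := xs ! 0]) | s. s < r}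
        in {1, -1} \<subseteq> A \<or> A = {0})"

abbreviation om :: "'a set \<Rightarrow> ('a list \<Rightarrow> int) \<Rightarrow> 'a set \<times> ('a list \<Rightarrow> int) set" where
  "om E chi \<equiv> (E, {chi, - chi})"

text \<open>Vanishing of \<open>chi\<close> and the degree condition below are invariant under \<open>chi \<mapsto> - chi\<close>,
  so the choice of the representative \<open>chi\<close> is immaterial.\<close>

definition uniform_oriented_matroid ::
    "nat \<Rightarrow> 'a::linorder set \<times> ('a list \<Rightarrow> int) set \<Rightarrow> bool" where
  "uniform_oriented_matroid r M \<longleftrightarrow>
     (\<exists>E chi. M = om E chi \<and> chirotope E r chi \<and> (\<forall>xs \<in> increasing_tuples E r. chi xs \<noteq> 0))"

definition degree_uniform_oriented_matroid ::
    "nat \<Rightarrow> 'a::linorder set \<times> ('a list \<Rightarrow> int) set \<Rightarrow> bool" where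
  "degree_uniform_oriented_matroid k M \<longleftrightarrow>
     uniform_oriented_matroid (k + 2) M \<and>
     (\<exists>E chi. M = om E chi \<and>
       (\<forall>xs \<in> increasing_tuples E (k + 3). \<forall>a \<in> set xs. \<forall>b \<in> set xs. \<forall>c \<in> set xs.
          a < b \<longrightarrow> b < c \<longrightarrow>
          chi (remove1 c xs) = - chi (remove1 b xs) \<longrightarrow>
          chi (remove1 a xs) = chi (remove1 b xs)))"


section \<open>Pseudoconfigurations of points\<close>

definition x_monotone_curve :: "(real \<times> real) set \<Rightarrow> bool" where
  "x_monotone_curve l \<longleftrightarrow> (\<exists>f. continuous_on UNIV f \<and> l = {(x, f x) | x. True})"

text \<open>The function of which the curve is the graph.\<close>

definition height :: "(real \<times> real) set \<Rightarrow> real \<Rightarrow> real" where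
  "height l x = (THE y. (x, y) \<in> l)"

definition above :: "(real \<times> real) set \<Rightarrow> (real \<times> real) set" where
  "above l = {(x, y). y > height l x}"

definition below :: "(real \<times> real) set \<Rightarrow> (real \<times> real) set" where
  "below l = {(x, y). y < height l x}"

definition crosses_upwards_at ::
    "(real \<times> real) set \<Rightarrow> (real \<times> real) set \<Rightarrow> real \<Rightarrow> bool" where
  "crosses_upwards_at l m x \<longleftrightarrow>
     (\<forall>\<^sub>F t in at_left x. height l t < height m t) \<and>
     (\<forall>\<^sub>F t in at_right x. height m t < height l t)"

definition transversal_at ::
    "(real \<times> real) set \<Rightarrow> (real \<times> real) set \<Rightarrow> real \<times> real \<Rightarrow> bool" where
  "transversal_at l m q \<longleftrightarrow>
     crosses_upwards_at l m (fst q) \<or> crosses_upwards_at m l (fst q)"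

text \<open>The point set is \<open>P = p ` {1..n}\<close>, labelled from left to right by \<open>p\<close>;
  the values of \<open>p\<close> outside \<open>{1..n}\<close> play no role.\<close>

definition pseudoconfiguration ::
    "nat \<Rightarrow> nat \<Rightarrow> (nat \<Rightarrow> real \<times> real) \<Rightarrow> (real \<times> real) set set \<Rightarrow> bool" where
  "pseudoconfiguration k n p L \<longleftrightarrow>
     strict_mono_on {1..n} (\<lambda>i. fst (p i)) \<and>
     (\<forall>l \<in> L. x_monotone_curve l) \<and>
     (\<forall>l \<in> L. card (p ` {1..n} \<inter> l) \<ge> k + 1) \<and>
     (\<forall>S. S \<subseteq> p ` {1..n} \<longrightarrow> card S = k + 1 \<longrightarrow> (\<exists>!l. l \<in> L \<and> S \<subseteq> l)) \<and>
     (\<forall>l \<in> L. \<forall>m \<in> L. l \<noteq> m \<longrightarrow>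
        finite (l \<inter> m) \<and> card (l \<inter> m) \<le> k \<and> (\<forall>q \<in> l \<inter> m. transversal_at l m q))"

definition general_position ::
    "nat \<Rightarrow> nat \<Rightarrow> (nat \<Rightarrow> real \<times> real) \<Rightarrow> (real \<times> real) set set \<Rightarrow> bool" where
  "general_position k n p L \<longleftrightarrow> (\<forall>l \<in> L. card (p ` {1..n} \<inter> l) = k + 1)"

definition curve_through ::
    "(real \<times> real) set set \<Rightarrow> (real \<times> real) set \<Rightarrow> (real \<times> real) set" where
  "curve_through L S = (THE l. l \<in> L \<and> S \<subseteq> l)"

definition is_chi_PP ::
    "nat \<Rightarrow> nat \<Rightarrow> (nat \<Rightarrow> real \<times> real) \<Rightarrow> (real \<times> real) set set \<Rightarrow> (nat list \<Rightarrow> int) \<Rightarrow> bool" where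
  "is_chi_PP k n p L chi \<longleftrightarrow>
     (\<forall>xs \<in> increasing_tuples {1..n} (k + 1). \<forall>j \<in> {1..n} - set xs.
        (p j \<in> above (curve_through L (p ` set xs)) \<longrightarrow> chi (xs @ [j]) = 1) \<and>
        (p j \<in> below (curve_through L (p ` set xs)) \<longrightarrow> chi (xs @ [j]) = - 1)) \<and>
     (\<forall>xs \<in> tuples {1..n} (k + 2). \<not> distinct xs \<longrightarrow> chi xs = 0) \<and>
     alternating_on {1..n} (k + 2) chi \<and>
     (\<forall>xs. xs \<notin> tuples {1..n} (k + 2) \<longrightarrow> chi xs = 0)"

text \<open>For a pseudoconfiguration in general position exactly one map satisfies \<open>is_chi_PP\<close>.\<close>

definition chi_PP ::
    "nat \<Rightarrow> nat \<Rightarrow> (nat \<Rightarrow> real \<times> real) \<Rightarrow> (real \<times> real) set set \<Rightarrow> nat list \<Rightarrow> int" where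
  "chi_PP k n p L = (THE chi. is_chi_PP k n p L chi)"

definition M_PP ::
    "nat \<Rightarrow> nat \<Rightarrow> (nat \<Rightarrow> real \<times> real) \<Rightarrow> (real \<times> real) set set
      \<Rightarrow> nat set \<times> (nat list \<Rightarrow> int) set" where
  "M_PP k n p L = om {1..n} (chi_PP k n p L)"

end

(* A degree-k chirotope is a signotope of rank k + 2. For a (k+1)-subset S record at every point j
   whether the curve of S shall pass below (-1), through (0) or above (1) it. Sweep from left to right
   and keep all curves linearly ordered: at j, stably sort them by their entry at j, and then reverse
   the block of curves through j. Two curves then cross only when they must: at common points and
   where the entries enforce it. If the curves of S and T crossed more than k times, there would be
   k + 2 points at which the sign of T - S weakly alternates; applied to S and to T, the lemma
   alternating_sign would give this (k+2)-set two opposite signs. *)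
theory Submission imports Defs begin

section \<open>Signotopes\<close>

text \<open>Crossings alone yield one point too few: k + 1 of them locate k + 1 sign changes,
  whereas \<open>alternating_sign\<close> speaks about k + 2 points. The missing point is
  \<open>first\<close>, where the two sign vectors differ for the first time. The order at the far
  left is therefore not arbitrary: it is chosen so that the sweep arrives at \<open>first\<close>
  with the two curves already placed as their entries there demand. This point is then no crossing
  and opens the alternating sequence. The linear orders are never built as such. Each curve carries
  a real number that works like a balanced ternary numeral with the newest digit most significant: a
  new entry overrules all earlier ones, and a tie falls back on the old order. Negating the older
  part at a digit 0 is the reversal of a block. The number depends on one curve only, so every
  argument can compare just two curves at a time.\<close>

locale signotope =
  fixes E :: "'a::linorder set" and k :: nat and X :: "'a set \<Rightarrow> int"
  assumes finite_E: "finite E"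
    and sign_cases: "K \<subseteq> E \<Longrightarrow> card K = k + 2 \<Longrightarrow> X K = 1 \<or> X K = -1"
    and monotone_packet: "K \<subseteq> E \<Longrightarrow> card K = k + 3 \<Longrightarrow> a \<in> K \<Longrightarrow> b \<in> K \<Longrightarrow> c \<in> K \<Longrightarrow>
      a < b \<Longrightarrow> b < c \<Longrightarrow> X (K - {c}) = - X (K - {b}) \<Longrightarrow> X (K - {a}) = X (K - {b})"

text \<open>In the order \<open>K - {c}\<close>, \<open>K - {b}\<close>, \<open>K - {a}\<close> the
  three signs change at most once. With values 1 and -1 only, this can be read from either end or
  from the outer two.\<close>

lemma (in signotope)
  assumes K: "K \<subseteq> E" "card K = k + 3" and abc: "a \<in> K" "b \<in> K" "c \<in> K" "a < b" "b < c"
  shows packet_middle: "X (K - {a}) = X (K - {c}) \<Longrightarrow> X (K - {b}) = X (K - {a})"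
    and packet_last: "X (K - {a}) = - X (K - {b}) \<Longrightarrow> X (K - {c}) = X (K - {b})"
proof -
  have sign: "X (K - {x}) = 1 \<or> X (K - {x}) = -1" if "x \<in> K" for x
  proof (rule sign_cases)
    show "K - {x} \<subseteq> E" using K by blast
    show "card (K - {x}) = k + 2" using K that finite_subset[OF K(1) finite_E] by simp
  qed
  show "X (K - {a}) = X (K - {c}) \<Longrightarrow> X (K - {b}) = X (K - {a})"
    "X (K - {a}) = - X (K - {b}) \<Longrightarrow> X (K - {c}) = X (K - {b})"
    using monotone_packet[OF K abc] sign[OF abc(1)] sign[OF abc(2)] sign[OF abc(3)] by linarith+
qed

lemma card_less_insert:
  assumes "finite A" "u \<notin> A"
  shows "card {z \<in> insert u A. z < y} = card {z \<in> A. z < y} + (if u < y then 1 else 0)"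
proof -
  have "{z \<in> insert u A. z < y} = (if u < y then insert u {z \<in> A. z < y} else {z \<in> A. z < y})"
    by auto
  then show ?thesis using assms by auto
qed

lemma parity_card_less_exchange:
  fixes J :: "'a::linorder set"
  assumes "finite J" "x \<in> J" "a \<notin> J"
  shows "(-1::int) ^ card {z \<in> insert a (J - {x}). z < y} =
    (-1) ^ card {z \<in> J. z < y} * (if (x < y) = (a < y) then 1 else -1)"
proof -
  have "J = insert x (J - {x})" using assms by auto
  then have "card {z \<in> J. z < y} = card {z \<in> J - {x}. z < y} + (if x < y then 1 else 0)"
    using card_less_insert[of "J - {x}" x y] assms by auto
  moreover have "card {z \<in> insert a (J - {x}). z < y} =
      card {z \<in> J - {x}. z < y} + (if a < y then 1 else 0)"
    using card_less_insert[of "J - {x}" a y] assms by auto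
  ultimately show ?thesis by auto
qed

text \<open>The combinatorial form of the fact that the divided difference of order \<open>k + 1\<close> over
  \<open>J\<close> ignores polynomials of degree \<open>k\<close>: if the points of \<open>J\<close> lie alternately above and below
  the curve of \<open>S\<close>, this determines the sign of \<open>J\<close>.\<close>

lemma (in signotope) alternating_sign:
  assumes "J \<subseteq> E" "card J = k + 2" and S: "S \<subseteq> E" "card S = k + 1"
    and "\<forall>x \<in> J - S. (-1) ^ card {s \<in> S. x < s} * X (insert x S) = (-1) ^ card {y \<in> J. y < x} * \<eta>"
  shows "X J = (-1) ^ (k + 1) * \<eta>"
  using assms(1,2,5)
proof (induction "card (J - S)" arbitrary: J \<eta> rule: less_induct)
  case less
  note J = \<open>J \<subseteq> E\<close> \<open>card J = k + 2\<close>
  note alt = less.prems(3)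
  have fin: "finite J" "finite S" using J S finite_E finite_subset by blast+
  have cJS: "card (J - S) = Suc (card (S - J))"
  proof -
    have "card (J - S) + card (J \<inter> S) = k + 2" "card (S - J) + card (J \<inter> S) = k + 1"
      using fin J S by (metis card_Int_Diff add.commute, metis card_Int_Diff add.commute Int_commute)
    then show ?thesis by simp
  qed
  show ?case
  proof (cases "S - J = {}")
    case True
    then have "card (J - S) = 1" using cJS by (metis One_nat_def card.empty)
    then obtain x where x: "J - S = {x}" by (auto simp: card_Suc_eq)
    then have Jx: "J = insert x S" "x \<notin> S" using True by auto
    \<comment> \<open>The elements of \<open>S\<close> below and above \<open>x\<close> number k + 1
      together; this turns one exponent into the other.\<close>
    have "{y \<in> J. y < x} = {y \<in> S. y < x}" using Jx by auto
    moreover have "S = {y \<in> S. y < x} \<union> {s \<in> S. x < s}" using Jx by (auto simp: not_less order.order_iff_strict)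
    then have "card S = card {y \<in> S. y < x} + card {s \<in> S. x < s}"
      using fin card_Un_disjoint[of "{y \<in> S. y < x}" "{s \<in> S. x < s}"] by fastforce
    ultimately have "k + 1 = card {y \<in> J. y < x} + card {s \<in> S. x < s}" using S by simp
    then have "(-1) ^ (k + 1) * \<eta> =
        (-1) ^ card {s \<in> S. x < s} * ((-1) ^ card {y \<in> J. y < x} * \<eta>)"
      by (simp add: power_add)
    also have "\<dots> = (-1) ^ card {s \<in> S. x < s} * ((-1) ^ card {s \<in> S. x < s} * X (insert x S))"
      using alt x by auto
    also have "\<dots> = X J" using Jx by simp
    finally show ?thesis by simp
  next
    case False
    then obtain a where a: "a \<in> S" "a \<notin> J" by auto
    let ?K = "insert a J"
    have K: "?K \<subseteq> E" "card ?K = k + 3" "?K - {a} = J" using a J S fin by auto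
    \<comment> \<open>Trading \<open>x\<close> for \<open>a\<close> shrinks \<open>J - S\<close>, so
      the induction hypothesis is available once alternation survives. The trade reverses the parity
      at exactly those \<open>y\<close> that separate \<open>x\<close> from \<open>a\<close>; hence
      the remaining \<open>y\<close> must all behave alike, which \<open>b\<close> records, and
      \<open>\<eta>\<close> is kept or negated.\<close>
    have exchange: "X (?K - {x}) = (-1) ^ (k + 1) * \<eta> * (if b then 1 else -1)"
      if x: "x \<in> J - S" and b: "\<forall>y \<in> J - S - {x}. ((x < y) = (a < y)) = b" for x b
    proof -
      let ?J = "insert a (J - {x})"
      have "?J - S = J - S - {x}" using a by auto
      then have "card (?J - S) < card (J - S)"
        using x fin by (metis card_Diff1_less finite_Diff)
      moreover have "?J \<subseteq> E" "card ?J = k + 2" using x a J S fin by auto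
      moreover have "(-1) ^ card {s \<in> S. y < s} * X (insert y S) =
          (-1) ^ card {z \<in> ?J. z < y} * (\<eta> * (if b then 1 else -1))" if "y \<in> ?J - S" for y
      proof -
        have y: "y \<in> J - S - {x}" using that a by auto
        then have "((x < y) = (a < y)) = b" using b by blast
        then show ?thesis using alt y parity_card_less_exchange[of J x a y] fin x a by auto
      qed
      ultimately have "X ?J = (-1) ^ (k + 1) * (\<eta> * (if b then 1 else -1))"
        using less.hyps[of ?J "\<eta> * (if b then 1 else -1)"] by blast
      moreover have "?K - {x} = ?J" using x a by auto
      ultimately show ?thesis by simp
    qed
    define A B where "A = {y \<in> J - S. y < a}" and "B = {y \<in> J - S. a < y}"
    have AB: "finite A" "finite B" using fin by (simp_all add: A_def B_def)
    have dich: "z < a \<or> a < z" if "z \<in> J - S" for z using that a by (metis DiffE neqE)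
    have card2: "card (J - S) \<ge> 2" using cJS False fin by (simp add: Suc_leI card_gt_0_iff)
    let ?v = "(-1) ^ (k + 1) * \<eta>"
    have two: "Min (J - S) < Max (J - S)" "Min (J - S) \<in> J - S" "Max (J - S) \<in> J - S"
    proof -
      have ne: "J - S \<noteq> {}" using card2 by (metis card.empty not_numeral_le_zero)
      then show "Min (J - S) \<in> J - S" "Max (J - S) \<in> J - S"
        using fin Min_in[of "J - S"] Max_in[of "J - S"] by blast+
      have "Min (J - S) \<noteq> Max (J - S)"
      proof
        assume "Min (J - S) = Max (J - S)"
        then have "\<forall>x \<in> J - S. x = Min (J - S)" using fin
          by (metis Max_ge Min_le antisym finite_Diff)
        then have "J - S \<subseteq> {Min (J - S)}" by blast
        then have "card (J - S) \<le> 1" using card_mono[of "{Min (J - S)}"] by simp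
        then show False using card2 by simp
      qed
      moreover have "Min (J - S) \<le> Max (J - S)"
        using fin ne by (intro Min_le Max_in) auto
      ultimately show "Min (J - S) < Max (J - S)" by simp
    qed
    have min_max: "Min (J - S) \<le> z" "z \<le> Max (J - S)" if "z \<in> J - S" for z
      using that Min_le[OF finite_Diff[OF fin(1)]] Max_ge[OF finite_Diff[OF fin(1)]] by blast+
    have inK: "a \<in> ?K" "Min (J - S) \<in> ?K" "Max (J - S) \<in> ?K" using two by auto
    consider "A \<noteq> {}" "B \<noteq> {}" | "B = {}" | "A = {}" by blast
    then show ?thesis
    proof cases
      case 1
      \<comment> \<open>These are the neighbours of \<open>a\<close> in \<open>J - S\<close>, so
        neither trade jumps over another element, and both give \<open>?v\<close>. The set
        \<open>J\<close> sits between them in the packet.\<close>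
      let ?x = "Max A" and ?y = "Min B"
      have "?x \<in> A" "?y \<in> B" using 1 AB by simp_all
      then have x: "?x \<in> J - S" "?x < a" and y: "?y \<in> J - S" "a < ?y"
        unfolding A_def B_def by blast+
      have "X (?K - {?x}) = ?v"
      proof -
        have "((?x < z) = (a < z)) = True" if "z \<in> J - S - {?x}" for z
        proof (cases "z \<in> A")
          case True
          then have "z \<le> ?x" "z < a" using AB(1) by (simp_all, simp add: A_def)
          then show ?thesis by auto
        next
          case False
          then have "a < z" using that dich unfolding A_def by blast
          then show ?thesis using x(2) by auto
        qed
        then show ?thesis using exchange[OF x(1), of True] by simp
      qed
      moreover have "X (?K - {?y}) = ?v"
      proof -
        have "((?y < z) = (a < z)) = True" if "z \<in> J - S - {?y}" for z
        proof (cases "z \<in> B")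
          case True
          then have "?y \<le> z" "z \<noteq> ?y" "a < z" using AB(2) that by (simp_all, simp add: B_def)
          then show ?thesis by auto
        next
          case False
          then have "z < a" using that dich unfolding B_def by blast
          then show ?thesis using y(2) by auto
        qed
        then show ?thesis using exchange[OF y(1), of True] by simp
      qed
      ultimately have "X (?K - {?x}) = X (?K - {?y})" by (rule trans[OF _ sym])
      then have "X (?K - {a}) = X (?K - {?x})"
        using packet_middle[OF K(1,2), of ?x a ?y] x y by blast
      then show ?thesis using \<open>X (?K - {?x}) = ?v\<close> unfolding K(3) by (rule trans)
    next
      case 2
      \<comment> \<open>All of \<open>J - S\<close> lies below \<open>a\<close>. Trading the largest
        element jumps over nothing, trading the smallest jumps over all others. The one permitted
        sign change of the packet is thereby used up, and \<open>J\<close> must agree with the first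
        trade. The third case is the mirror image.\<close>
      let ?x = "Max (J - S)" and ?y = "Min (J - S)"
      have lt: "z < a" if "z \<in> J - S" for z using that 2 dich unfolding B_def by blast
      have "X (?K - {?x}) = ?v"
      proof -
        have "((?x < z) = (a < z)) = True" if "z \<in> J - S - {?x}" for z
        proof -
          have "z < a" "z \<le> ?x" "z \<noteq> ?x" using that lt[of z] min_max[of z] by blast+
          then show ?thesis by auto
        qed
        then show ?thesis using exchange[OF two(3), of True] by simp
      qed
      moreover have "X (?K - {?y}) = - ?v"
      proof -
        have "((?y < z) = (a < z)) = False" if "z \<in> J - S - {?y}" for z
        proof -
          have "z < a" "?y \<le> z" "z \<noteq> ?y" using that lt[of z] min_max[of z] by blast+
          then show ?thesis by auto
        qed
        then show ?thesis using exchange[OF two(2), of False] by simp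
      qed
      ultimately have "X (?K - {?y}) = - X (?K - {?x})" by (simp only:)
      then have "X (?K - {a}) = X (?K - {?x})"
        by (rule packet_last[OF K(1,2) inK(2,3,1) two(1) lt[OF two(3)]])
      then show ?thesis using \<open>X (?K - {?x}) = ?v\<close> unfolding K(3) by (rule trans)
    next
      case 3
      let ?x = "Max (J - S)" and ?y = "Min (J - S)"
      have gt: "a < z" if "z \<in> J - S" for z using that 3 dich unfolding A_def by blast
      have "X (?K - {?x}) = - ?v"
      proof -
        have "((?x < z) = (a < z)) = False" if "z \<in> J - S - {?x}" for z
        proof -
          have "a < z" "z \<le> ?x" "z \<noteq> ?x" using that gt[of z] min_max[of z] by blast+
          then show ?thesis by auto
        qed
        then show ?thesis using exchange[OF two(3), of False] by simp
      qed
      moreover have "X (?K - {?y}) = ?v"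
      proof -
        have "((?y < z) = (a < z)) = True" if "z \<in> J - S - {?y}" for z
        proof -
          have "a < z" "?y \<le> z" "z \<noteq> ?y" using that gt[of z] min_max[of z] by blast+
          then show ?thesis by auto
        qed
        then show ?thesis using exchange[OF two(2), of True] by simp
      qed
      ultimately have "X (?K - {?x}) = - X (?K - {?y})" by (simp only:)
      then have "X (?K - {a}) = X (?K - {?y})"
        by (rule monotone_packet[OF K(1,2) inK gt[OF two(2)] two(1)])
      then show ?thesis using \<open>X (?K - {?y}) = ?v\<close> unfolding K(3) by (rule trans)
    qed
  qed
qed

section \<open>Heights of the curves\<close>

text \<open>\<open>bwd c n 1\<close> are the initial heights: curves are compared at the first point that
  separates them, with one reversal for every earlier common point. \<open>fwd n c i\<close> is the height
  between points \<open>i\<close> and \<open>i + 1\<close>, \<open>mid n c i\<close> the one at point \<open>i + 1\<close>. The power of 3 exceeds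
  all differences of previous heights, so that the entry of \<open>c\<close> decides, and otherwise
  the previous order is kept, or reversed at a common point.\<close>

primrec bwd :: "(nat \<Rightarrow> real) \<Rightarrow> nat \<Rightarrow> nat \<Rightarrow> real" where
  "bwd c 0 j = 0"
| "bwd c (Suc m) j = c j * 3 ^ m + (if c j = 0 then -1 else 1) * bwd c m (Suc j)"

primrec fwd :: "nat \<Rightarrow> (nat \<Rightarrow> real) \<Rightarrow> nat \<Rightarrow> real" where
  "fwd n c 0 = bwd c n 1"
| "fwd n c (Suc i) = c (Suc i) * 3 ^ (n + i) + (if c (Suc i) = 0 then -1 else 1) * fwd n c i"

definition mid :: "nat \<Rightarrow> (nat \<Rightarrow> real) \<Rightarrow> nat \<Rightarrow> real" where
  "mid n c i = c (Suc i) * 3 ^ (n + i) + (if c (Suc i) = 0 then 0 else fwd n c i)"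

definition sign_vector :: "(nat \<Rightarrow> real) \<Rightarrow> bool" where
  "sign_vector c \<longleftrightarrow> (\<forall>j. c j \<in> {-1, 0, 1})"

lemma sign_vectorE:
  assumes "sign_vector c"
  obtains "c j = -1" | "c j = 0" | "c j = 1"
  using assms unfolding sign_vector_def by blast

text \<open>The base 3 comes from the step \<open>2 * 3 ^ m + 3 ^ m = 3 ^ (m + 1)\<close>. The
  factor 2 makes the difference of two such heights smaller than the next power.\<close>

lemma bwd_bound: "sign_vector c \<Longrightarrow> 2 * \<bar>bwd c m j\<bar> < 3 ^ m"
proof (induction m arbitrary: j)
  case (Suc m)
  have "2 * \<bar>bwd c m (Suc j)\<bar> < 3 ^ m" using Suc by blast
  with Suc.prems show ?case by (cases rule: sign_vectorE[where j = j]) (auto simp: abs_if split: if_splits)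
qed simp

lemma fwd_bound: "sign_vector c \<Longrightarrow> 2 * \<bar>fwd n c i\<bar> < 3 ^ (n + i)"
proof (induction i)
  case 0
  then show ?case using bwd_bound by simp
next
  case (Suc i)
  then have "2 * \<bar>fwd n c i\<bar> < 3 ^ (n + i)" by blast
  with Suc.prems show ?case by (cases rule: sign_vectorE[where j = "Suc i"]) (auto simp: abs_if split: if_splits)
qed

text \<open>Distinct entries differ by at least 1, so they contribute at least \<open>M\<close>,
  while \<open>v - u\<close> stays below \<open>M\<close> in absolute value.\<close>

lemma dominant_difference:
  fixes u v M :: real
  assumes "sign_vector c" "sign_vector d" "c j \<noteq> d j" "2 * \<bar>u\<bar> < M" "2 * \<bar>v\<bar> < M"
  shows "(d j - c j) * ((d j * M + v) - (c j * M + u)) > 0"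
proof -
  have "-M < 2 * u" "2 * u < M" "-M < 2 * v" "2 * v < M" using assms(4,5) by linarith+
  then show ?thesis using assms(3)
    by (cases rule: sign_vectorE[OF assms(1), of j]; cases rule: sign_vectorE[OF assms(2), of j])
      simp_all
qed

section \<open>Comparison of two sign vectors along the sweep\<close>

locale sign_vector_pair =
  fixes n :: nat and c d :: "nat \<Rightarrow> real"
  assumes sv: "sign_vector c" "sign_vector d"
    and differ: "\<exists>j \<in> {1..n}. c j \<noteq> d j"
begin

definition D :: "nat \<Rightarrow> real" where "D i = fwd n d i - fwd n c i"

definition D' :: "nat \<Rightarrow> real" where "D' i = mid n d i - mid n c i"

lemma bwd_diff_pos:
  "c j \<noteq> d j \<Longrightarrow> (d j - c j) * (bwd d (Suc m) j - bwd c (Suc m) j) > 0"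
  using dominant_difference[OF sv, of j "(if c j = 0 then -1 else 1) * bwd c m (Suc j)" "3 ^ m"
      "(if d j = 0 then -1 else 1) * bwd d m (Suc j)"] bwd_bound[OF sv(1)] bwd_bound[OF sv(2)]
  by (simp add: abs_mult)

lemma D_Suc_differ: "c (Suc i) \<noteq> d (Suc i) \<Longrightarrow> (d (Suc i) - c (Suc i)) * D (Suc i) > 0"
  using dominant_difference[OF sv, of "Suc i" "(if c (Suc i) = 0 then -1 else 1) * fwd n c i" "3 ^ (n + i)"
      "(if d (Suc i) = 0 then -1 else 1) * fwd n d i"] fwd_bound[OF sv(1)] fwd_bound[OF sv(2)]
  by (simp add: abs_mult D_def)

lemma D'_differ: "c (Suc i) \<noteq> d (Suc i) \<Longrightarrow> (d (Suc i) - c (Suc i)) * D' i > 0"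
  using dominant_difference[OF sv, of "Suc i" "(if c (Suc i) = 0 then 0 else 1) * fwd n c i" "3 ^ (n + i)"
      "(if d (Suc i) = 0 then 0 else 1) * fwd n d i"] fwd_bound[OF sv(1), of n i] fwd_bound[OF sv(2), of n i]
  by (cases "c (Suc i) = 0"; cases "d (Suc i) = 0") (simp_all add: abs_mult D'_def mid_def)

lemma D_Suc_equal:
  "c (Suc i) = d (Suc i) \<Longrightarrow> D (Suc i) = (if c (Suc i) = 0 then -1 else 1) * D i"
  by (simp add: D_def)

lemma D'_equal: "c (Suc i) = d (Suc i) \<Longrightarrow> D' i = (if c (Suc i) = 0 then 0 else D i)"
  by (simp add: D'_def D_def mid_def)

definition first :: nat where "first = (LEAST j. j \<in> {1..n} \<and> c j \<noteq> d j)"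

lemma first: "first \<in> {1..n}" "c first \<noteq> d first"
  using LeastI_ex[of "\<lambda>j. j \<in> {1..n} \<and> c j \<noteq> d j"] differ unfolding first_def by blast+

lemma before_first: "1 \<le> j \<Longrightarrow> j < first \<Longrightarrow> c j = d j"
  using not_less_Least[of j "\<lambda>j. j \<in> {1..n} \<and> c j \<noteq> d j"] first unfolding first_def by fastforce

text \<open>A common zero causes one reversal in \<open>bwd\<close> and one in \<open>fwd\<close>.
  The two cancel, so what remains before \<open>first\<close> is the initial comparison of the tails
  not yet swept.\<close>

lemma D_before_first: "i < first \<Longrightarrow> D i = bwd d (n - i) (Suc i) - bwd c (n - i) (Suc i)"
proof (induction i)
  case 0
  then show ?case by (simp add: D_def)
next
  case (Suc i)
  have eq: "c (Suc i) = d (Suc i)" using before_first Suc.prems by simp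
  have "n - i = Suc (n - Suc i)" using Suc.prems first by auto
  then have "D i = (if c (Suc i) = 0 then -1 else 1) *
      (bwd d (n - Suc i) (Suc (Suc i)) - bwd c (n - Suc i) (Suc (Suc i)))"
    using Suc eq by simp
  then show ?case using D_Suc_equal[OF eq] by simp
qed

text \<open>This is what the choice of the initial heights is for.\<close>

lemma no_flip_at_first: "(d first - c first) * D (first - 1) > 0"
proof -
  have "first - 1 < first" "Suc (first - 1) = first" "n - (first - 1) = Suc (n - first)"
    using first by auto
  then show ?thesis using D_before_first[of "first - 1"] bwd_diff_pos[OF first(2)] by simp
qed

text \<open>Equal entries change \<open>D\<close> at most in sign, so nonvanishing travels backwards
  from \<open>first - 1\<close> to 0; from there it travels forwards, unequal entries enforcing it
  anew.\<close>

lemma D_nonzero: "D i \<noteq> 0"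
proof -
  have "D i \<noteq> 0" if "i < first" for i
    using that
  proof (induction "first - 1 - i" arbitrary: i)
    case 0
    then have "i = first - 1" by simp
    then show ?case using no_flip_at_first by auto
  next
    case (Suc m)
    then have "D (Suc i) \<noteq> 0" by simp
    moreover have "c (Suc i) = d (Suc i)" using before_first[of "Suc i"] Suc(2) by simp
    ultimately show ?case using D_Suc_equal by fastforce
  qed
  then have 0: "D 0 \<noteq> 0" using first by auto
  show ?thesis
  proof (induction i)
    case (Suc i)
    then show ?case using D_Suc_equal[of i] D_Suc_differ[of i] by (cases "c (Suc i) = d (Suc i)") auto
  qed (rule 0)
qed

definition flips :: "nat set" where "flips = {i \<in> {1..n}. D (i - 1) * D i < 0}"

lemma D_sign: "i \<le> n \<Longrightarrow> (-1) ^ card {z \<in> flips. z \<le> i} * D i * D 0 > 0"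
proof (induction i)
  case 0
  have "{z \<in> flips. z \<le> 0} = {}" by (auto simp: flips_def)
  then have "card {z \<in> flips. z \<le> 0} = 0" by (simp only: card.empty)
  moreover have "D 0 * D 0 > 0" using D_nonzero[of 0] by (auto simp: zero_less_mult_iff neq_iff)
  ultimately show ?case by (simp only: power_0 mult_1)
next
  case (Suc i)
  have fin: "finite {z \<in> flips. z \<le> i}" by (auto simp: flips_def)
  have IH: "(-1) ^ card {z \<in> flips. z \<le> i} * D i * D 0 > 0" using Suc by simp
  show ?case
  proof (cases "Suc i \<in> flips")
    case True
    then have "{z \<in> flips. z \<le> Suc i} = insert (Suc i) {z \<in> flips. z \<le> i}" by auto
    then have "card {z \<in> flips. z \<le> Suc i} = Suc (card {z \<in> flips. z \<le> i})" using fin by simp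
    moreover have "D i * D (Suc i) < 0" using True by (auto simp: flips_def)
    ultimately show ?thesis using IH
      by (auto simp: zero_less_mult_iff mult_less_0_iff)
  next
    case False
    then have "{z \<in> flips. z \<le> Suc i} = {z \<in> flips. z \<le> i}" by (auto simp: le_Suc_eq)
    moreover have "D i * D (Suc i) > 0" using False Suc.prems D_nonzero[of i] D_nonzero[of "Suc i"]
      by (auto simp: flips_def not_less order.order_iff_strict)
    ultimately show ?thesis using IH
      by (auto simp: zero_less_mult_iff mult_less_0_iff)
  qed
qed

lemma first_notin_flips: "first \<notin> flips"
proof
  assume "first \<in> flips"
  then have "D (first - 1) * D first < 0" by (simp add: flips_def)
  moreover have "(d first - c first) * D first > 0"
    using D_Suc_differ[of "first - 1"] first by simp
  ultimately show False using no_flip_at_first by (auto simp: zero_less_mult_iff mult_less_0_iff)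
qed

text \<open>The entries at a flip either are both 0 or differ, because equal nonzero entries keep
  the order. Where they differ, \<open>d j - c j\<close> has the sign of \<open>D j\<close>, and
  that sign alternates from flip to flip.\<close>

lemma flips_alternate:
  assumes j: "j \<in> insert first flips" and cd: "\<not> (c j = 0 \<and> d j = 0)"
  shows "(-1) ^ card {z \<in> insert first flips. z < j} * (d j - c j) * D 0 > 0"
proof -
  have jn: "j \<in> {1..n}" using j first by (auto simp: flips_def)
  then obtain i where i: "j = Suc i" by (cases j) auto
  have ne: "c j \<noteq> d j"
  proof
    assume eq: "c j = d j"
    then have "j \<in> flips" using j first by auto
    then have "D i * D (Suc i) < 0" by (simp add: flips_def i)
    moreover have "D (Suc i) = D i" using eq cd D_Suc_equal[of i] i by simp
    ultimately show False by (simp add: mult_less_0_iff)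
  qed
  have fin: "finite {z \<in> flips. P z}" for P by (auto simp: flips_def)
  \<comment> \<open>For a flip \<open>j\<close> after \<open>first\<close>, one side counts
    \<open>first\<close> but not \<open>j\<close>, the other \<open>j\<close> but not
    \<open>first\<close>.\<close>
  have "card {z \<in> insert first flips. z < j} = card {z \<in> flips. z \<le> j}"
  proof (cases "j = first")
    case True
    have "{z \<in> insert first flips. z < first} = {z \<in> flips. z \<le> first}"
      using first_notin_flips by (auto simp: order.order_iff_strict)
    then show ?thesis using True by simp
  next
    case False
    then have "first < j" using before_first[of j] ne jn by (meson atLeastAtMost_iff linorder_neqE_nat)
    then have "{z \<in> insert first flips. z < j} = insert first {z \<in> flips. z < j}" by auto
    moreover have "{z \<in> flips. z \<le> j} = insert j {z \<in> flips. z < j}" using j False by auto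
    ultimately show ?thesis using fin first_notin_flips by simp
  qed
  moreover have "(d j - c j) * D j > 0" using D_Suc_differ ne i by simp
  ultimately show ?thesis using D_sign[of j] jn by (auto simp: zero_less_mult_iff mult_less_0_iff)
qed

end

section \<open>Piecewise linear curves\<close>

text \<open>A sum of clamped ramps: the linear interpolation of \<open>H\<close> at 0, ...,
  \<open>N\<close>, constant outside. In this closed form continuity and linearity in
  \<open>H\<close> are immediate.\<close>

definition pl :: "nat \<Rightarrow> (nat \<Rightarrow> real) \<Rightarrow> real \<Rightarrow> real" where
  "pl N H x = H 0 + (\<Sum>i<N. (H (Suc i) - H i) * max 0 (min 1 (x - real i)))"

lemma continuous_pl: "continuous_on UNIV (pl N H)"
  unfolding pl_def by (intro continuous_intros)

lemma pl_diff: "pl N H x - pl N G x = pl N (\<lambda>i. H i - G i) x"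
  by (simp add: pl_def algebra_simps sum_subtractf sum.distrib)

lemma pl_left: "x \<le> 0 \<Longrightarrow> pl N H x = H 0"
  by (simp add: pl_def)

lemma pl_right:
  assumes "real N \<le> x"
  shows "pl N H x = H N"
proof -
  have "(\<Sum>i<N. (H (Suc i) - H i) * max 0 (min 1 (x - real i))) = (\<Sum>i<N. H (Suc i) - H i)"
    using assms by (intro sum.cong) (auto simp: min_def max_def)
  then show ?thesis by (simp add: pl_def sum_lessThan_telescope)
qed

lemma pl_segment:
  assumes "m < N" "real m \<le> x" "x \<le> real m + 1"
  shows "pl N H x = H m + (H (Suc m) - H m) * (x - real m)"
proof -
  have "(\<Sum>i<N. (H (Suc i) - H i) * max 0 (min 1 (x - real i))) =
      (\<Sum>i<Suc m. (H (Suc i) - H i) * max 0 (min 1 (x - real i)))"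
    using assms by (intro sum.mono_neutral_right) (auto simp: not_less)
  also have "\<dots> = (\<Sum>i<m. H (Suc i) - H i) + (H (Suc m) - H m) * (x - real m)"
  proof -
    have "(\<Sum>i<m. (H (Suc i) - H i) * max 0 (min 1 (x - real i))) = (\<Sum>i<m. H (Suc i) - H i)"
      using assms by (intro sum.cong) (auto simp: min_def max_def)
    then show ?thesis using assms by (simp add: min_def max_def)
  qed
  finally show ?thesis by (simp add: pl_def sum_lessThan_telescope)
qed

lemma pl_nat: "m \<le> N \<Longrightarrow> pl N H (real m) = H m"
  by (cases "m = N") (auto simp: pl_right pl_segment[of m])

section \<open>Zeros of piecewise linear functions\<close>

lemma segment_crossing:
  fixes a b x :: real
  assumes "a * b < 0"
  defines "z \<equiv> a / (a - b)"
  shows "0 < z" "z < 1"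
    "x < z \<Longrightarrow> (a + (b - a) * x) * a > 0" "z < x \<Longrightarrow> (a + (b - a) * x) * b > 0"
proof -
  have pos: "a * (a - b) > 0" "b * (a - b) < 0"
    using assms(1) by (auto simp: mult_less_0_iff zero_less_mult_iff)
  then have ab: "a - b \<noteq> 0" by auto
  show "0 < z" "z < 1"
    using assms(1) by (auto simp: z_def mult_less_0_iff field_simps)
  have eq: "a + (b - a) * t = (a - b) * (z - t)" for t
    using ab by (simp add: z_def field_simps)
  have "(a + (b - a) * x) * a = (a * (a - b)) * (z - x)" "(a + (b - a) * x) * b = (b * (a - b)) * (z - x)"
    by (simp_all add: eq)
  then show "x < z \<Longrightarrow> (a + (b - a) * x) * a > 0" "z < x \<Longrightarrow> (a + (b - a) * x) * b > 0"
    using pos by (simp_all only:) (simp_all add: mult_pos_pos mult_neg_neg)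
qed

lemma segment_same_sign:
  fixes a b x :: real
  assumes "a * b \<ge> 0" "b \<noteq> 0" "0 < x" "x \<le> 1"
  shows "(a + (b - a) * x) * b > 0"
proof -
  have "(a + (b - a) * x) * b = (1 - x) * (a * b) + x * (b * b)" by (simp add: algebra_simps)
  moreover have "x * (b * b) > 0" "(1 - x) * (a * b) \<ge> 0" using assms by (auto simp flip: power2_eq_square)
  ultimately show ?thesis by linarith
qed

definition crosses_zero_at :: "(real \<Rightarrow> real) \<Rightarrow> real \<Rightarrow> bool" where
  "crosses_zero_at u x \<longleftrightarrow>
     ((\<forall>\<^sub>F t in at_left x. u t < 0) \<and> (\<forall>\<^sub>F t in at_right x. 0 < u t)) \<or>
     ((\<forall>\<^sub>F t in at_left x. 0 < u t) \<and> (\<forall>\<^sub>F t in at_right x. u t < 0))"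

lemma crosses_zero_atI:
  assumes "a * b < 0" "y < x" "x < z"
    and "\<And>t. y < t \<Longrightarrow> t < x \<Longrightarrow> u t * a > 0" "\<And>t. x < t \<Longrightarrow> t < z \<Longrightarrow> u t * b > 0"
  shows "crosses_zero_at u x"
proof -
  have "\<forall>\<^sub>F t in at_left x. u t * a > 0"
    using eventually_at_left_real[OF assms(2)] by eventually_elim (use assms in auto)
  moreover have "\<forall>\<^sub>F t in at_right x. u t * b > 0"
    using eventually_at_right_real[OF assms(3)] by eventually_elim (use assms in auto)
  ultimately show ?thesis using assms(1) unfolding crosses_zero_at_def
    by (cases "a > 0") (auto simp: zero_less_mult_iff mult_less_0_iff)
qed

text \<open>A block consists of the two segments around one point of the configuration. In the first
  alternative of \<open>mid\<close> both curves meet at that point. In the second the middle value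
  already has the final sign, so the right segment has no zero and a crossing can only occur in the
  left one.\<close>

lemma pl_block:
  assumes m: "m + 2 \<le> N" and nz: "H m \<noteq> 0" "H (m + 2) \<noteq> 0"
    and mid: "H (m + 1) = 0 \<and> H m * H (m + 2) < 0 \<or> H (m + 1) * H (m + 2) > 0"
  shows "\<exists>x0. real m < x0 \<and> x0 < real m + 2 \<and>
    (\<forall>x \<in> {real m..real m + 2}. pl N H x = 0 \<longrightarrow> x = x0 \<and> H m * H (m + 2) < 0 \<and> crosses_zero_at (pl N H) x)"
proof -
  have s1: "pl N H x = H m + (H (m + 1) - H m) * (x - real m)"
    if "real m \<le> x" "x \<le> real m + 1" for x
    using pl_segment[of m N x H] m that by simp
  have s2: "pl N H x = H (m + 1) + (H (m + 2) - H (m + 1)) * (x - real m - 1)"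
    if "real m + 1 \<le> x" "x \<le> real m + 2" for x
    using pl_segment[of "m + 1" N x H] m that by (simp add: algebra_simps)
  have right: "pl N H x * H (m + 2) > 0" if "real m + 1 < x" "x \<le> real m + 2" for x
  proof -
    have "H (m + 1) * H (m + 2) \<ge> 0" using mid by auto
    then show ?thesis
      using segment_same_sign[of "H (m + 1)" "H (m + 2)" "x - real m - 1"] nz that s2[of x] by simp
  qed
  consider "H (m + 1) = 0" "H m * H (m + 2) < 0" | "H (m + 1) * H (m + 2) > 0" "H m * H (m + 1) < 0"
    | "H (m + 1) * H (m + 2) > 0" "H m * H (m + 1) > 0"
    using mid nz by (auto simp: zero_less_mult_iff mult_less_0_iff neq_iff)
  then show ?thesis
  proof cases
    case 1
    have left: "pl N H x * H m > 0" if "real m \<le> x" "x < real m + 1" for x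
    proof -
      have eq: "pl N H x = (1 - (x - real m)) * H m" using s1[of x] that 1
        by (simp add: algebra_simps)
      have "H m * H m > 0" "1 - (x - real m) > 0" using nz that by (auto simp: zero_less_mult_iff neq_iff)
      then show ?thesis by (simp only: eq mult.assoc mult_pos_pos)
    qed
    have "crosses_zero_at (pl N H) (real m + 1)"
      by (rule crosses_zero_atI[OF 1(2), of "real m" _ "real m + 2"];
          (rule left; linarith | rule right; linarith | linarith))
    moreover have "x = real m + 1" if "x \<in> {real m..real m + 2}" "pl N H x = 0" for x
      using left[of x] right[of x] that by (cases "x = real m + 1") (auto simp: neq_iff)
    ultimately show ?thesis using 1 by (intro exI[of _ "real m + 1"]) auto
  next
    case 2
    define z where "z = H m / (H m - H (m + 1))"
    note seg = segment_crossing[OF 2(2), folded z_def]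
    have neg: "H m * H (m + 2) < 0" using 2 by (auto simp: zero_less_mult_iff mult_less_0_iff)
    have left: "pl N H x * H m > 0" if "real m \<le> x" "x < real m + z" for x
      using seg(3)[of "x - real m"] seg(2) s1[of x] that by simp
    have right': "pl N H x * H (m + 2) > 0" if "real m + z < x" "x \<le> real m + 2" for x
    proof (cases "x \<le> real m + 1")
      case True
      then have "pl N H x * H (m + 1) > 0"
        using seg(4)[of "x - real m"] seg(1) s1[of x] that by simp
      then show ?thesis using 2 by (auto simp: zero_less_mult_iff mult_less_0_iff)
    qed (use right that in auto)
    have "crosses_zero_at (pl N H) (real m + z)"
      by (rule crosses_zero_atI[OF neg, of "real m" _ "real m + 2"]; insert seg(1,2);
          (rule left; linarith | rule right'; linarith | linarith))
    moreover have "x = real m + z" if "x \<in> {real m..real m + 2}" "pl N H x = 0" for x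
      using left[of x] right'[of x] that by (cases "x = real m + z") (auto simp: neq_iff)
    ultimately show ?thesis using neg seg by (intro exI[of _ "real m + z"]) auto
  next
    case 3
    have "pl N H x \<noteq> 0" if x: "x \<in> {real m..real m + 2}" for x
    proof -
      consider "x = real m" | "real m < x" "x \<le> real m + 1" | "real m + 1 < x"
        using x by fastforce
      then show ?thesis
      proof cases
        case 1
        then show ?thesis using s1[of x] nz by simp
      next
        case 2
        have "H m * H (m + 1) \<ge> 0" "H (m + 1) \<noteq> 0" using 3 by auto
        from segment_same_sign[OF this, of "x - real m"] show ?thesis using 2 s1[of x] by auto
      next
        case 3
        then show ?thesis using right that by fastforce
      qed
    qed
    \<comment> \<open>Without a zero in the block, any interior abscissa serves as witness.\<close>
    then show ?thesis by (intro exI[of _ "real m + 1"]) auto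
  qed
qed

lemma pl_zeros:
  assumes nz: "\<And>i. i \<le> n \<Longrightarrow> H (2 * i) \<noteq> 0"
    and mid: "\<And>i. i < n \<Longrightarrow> H (2 * i + 1) = 0 \<and> H (2 * i) * H (2 * i + 2) < 0 \<or>
        H (2 * i + 1) * H (2 * i + 2) > 0"
  defines "Z \<equiv> {x. pl (2 * n) H x = 0}"
  shows "finite Z" "card Z \<le> card {i \<in> {1..n}. H (2 * (i - 1)) * H (2 * i) < 0}"
    "\<And>x. x \<in> Z \<Longrightarrow> crosses_zero_at (pl (2 * n) H) x"
proof -
  let ?F = "{i \<in> {1..n}. H (2 * (i - 1)) * H (2 * i) < 0}"
  have "\<forall>i. \<exists>x0. i < n \<longrightarrow> (\<forall>x \<in> {real (2 * i)..real (2 * i) + 2}. pl (2 * n) H x = 0 \<longrightarrow>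
      x = x0 \<and> H (2 * i) * H (2 * i + 2) < 0 \<and> crosses_zero_at (pl (2 * n) H) x)"
  proof
    fix i
    show "\<exists>x0. i < n \<longrightarrow> (\<forall>x \<in> {real (2 * i)..real (2 * i) + 2}. pl (2 * n) H x = 0 \<longrightarrow>
      x = x0 \<and> H (2 * i) * H (2 * i + 2) < 0 \<and> crosses_zero_at (pl (2 * n) H) x)"
      using pl_block[of "2 * i" "2 * n" H] nz[of i] nz[of "i + 1"] mid[of i] by (cases "i < n") auto
  qed
  then obtain x0 where x0: "\<And>i x. i < n \<Longrightarrow> x \<in> {real (2 * i)..real (2 * i) + 2} \<Longrightarrow> pl (2 * n) H x = 0 \<Longrightarrow>
      x = x0 i \<and> H (2 * i) * H (2 * i + 2) < 0 \<and> crosses_zero_at (pl (2 * n) H) x"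
    by metis
  have block: "\<exists>i<n. x \<in> {real (2 * i)..real (2 * i) + 2}" if "x \<in> Z" for x
  proof -
    have "0 < x" "x < real (2 * n)"
      using that nz[of 0] nz[of n] pl_left[of x "2 * n" H] pl_right[of "2 * n" x H]
      by (auto simp: Z_def not_less[symmetric])
    then show ?thesis
      \<comment> \<open>Blocks have length 2, so halving and rounding down gives the index.\<close>
      by (intro exI[of _ "nat \<lfloor>x / 2\<rfloor>"]) (auto simp: nat_less_iff floor_less_iff, linarith+)
  qed
  \<comment> \<open>Blocks are numbered from 0, sign changes from 1; hence the shift.\<close>
  have "Z \<subseteq> (\<lambda>i. x0 (i - 1)) ` ?F"
  proof
    fix x assume x: "x \<in> Z"
    then obtain i where "i < n" "x \<in> {real (2 * i)..real (2 * i) + 2}" using block by blast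
    then have "x = x0 i" "H (2 * i) * H (2 * i + 2) < 0" using x0[of i x] x by (auto simp: Z_def)
    then show "x \<in> (\<lambda>i. x0 (i - 1)) ` ?F" using \<open>i < n\<close> by (intro image_eqI[of _ _ "Suc i"]) auto
  qed
  then show "finite Z" "card Z \<le> card ?F"
    by (auto intro: finite_subset surj_card_le)
  show "crosses_zero_at (pl (2 * n) H) x" if "x \<in> Z" for x
    using block[OF that] x0 that by (auto simp: Z_def)
qed

text \<open>Even abscissas carry the order between consecutive points, odd ones the points
  themselves: point \<open>Suc i\<close> sits at \<open>2 * i + 1\<close>. The extra node lets a
  curve pass the point on its prescribed side before the next order is reached.\<close>

definition heights :: "nat \<Rightarrow> (nat \<Rightarrow> real) \<Rightarrow> nat \<Rightarrow> real" where
  "heights n c m = (if even m then fwd n c (m div 2) else mid n c (m div 2))"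

definition curve :: "nat \<Rightarrow> (nat \<Rightarrow> real) \<Rightarrow> real \<Rightarrow> real" where
  "curve n c = pl (2 * n) (heights n c)"

lemma curve_at_point:
  assumes "sign_vector c" "j \<in> {1..n}"
  shows "c j = 0 \<Longrightarrow> curve n c (real (2 * j - 1)) = 0"
    "c j = 1 \<Longrightarrow> curve n c (real (2 * j - 1)) > 0"
    "c j = -1 \<Longrightarrow> curve n c (real (2 * j - 1)) < 0"
proof -
  obtain i where i: "j = Suc i" using assms(2) by (cases j) auto
  have "curve n c (real (2 * j - 1)) = heights n c (2 * i + 1)"
    using pl_nat[of "2 * i + 1" "2 * n" "heights n c"] assms(2) by (simp add: curve_def i)
  then have "curve n c (real (2 * j - 1)) = mid n c i" by (simp add: heights_def)
  then show "c j = 0 \<Longrightarrow> curve n c (real (2 * j - 1)) = 0"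
    "c j = 1 \<Longrightarrow> curve n c (real (2 * j - 1)) > 0"
    "c j = -1 \<Longrightarrow> curve n c (real (2 * j - 1)) < 0"
    using fwd_bound[OF assms(1), of n i] by (auto simp: mid_def i abs_if split: if_splits)
qed

lemma (in sign_vector_pair) curve_crossings:
  defines "u \<equiv> \<lambda>x. curve n d x - curve n c x"
  shows "finite {x. u x = 0}" "card {x. u x = 0} \<le> card flips"
    "\<And>x. u x = 0 \<Longrightarrow> crosses_zero_at u x"
proof -
  define G where "G = (\<lambda>m. heights n d m - heights n c m)"
  have u: "u = pl (2 * n) G" by (auto simp: u_def curve_def G_def pl_diff)
  have G: "G (2 * i) = D i" "G (2 * i + 1) = D' i" "G (2 * i + 2) = D (Suc i)" for i
    by (simp_all add: G_def heights_def D_def D'_def)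
  \<comment> \<open>A common zero gives the first alternative. For equal nonzero entries all three
    values coincide; for unequal entries the last two share the sign that the entries
    dictate.\<close>
  have "G (2 * i + 1) = 0 \<and> G (2 * i) * G (2 * i + 2) < 0 \<or> G (2 * i + 1) * G (2 * i + 2) > 0" for i
  proof (cases "c (Suc i) = d (Suc i)")
    case True
    have "D i * D i > 0" using D_nonzero[of i] by (auto simp: zero_less_mult_iff neq_iff)
    then show ?thesis using D_Suc_equal[OF True] D'_equal[OF True] unfolding G by auto
  next
    case False
    then show ?thesis using D_Suc_differ[OF False] D'_differ[OF False] unfolding G
      by (auto simp: zero_less_mult_iff)
  qed
  note zeros = pl_zeros[of n G, OF _ this, folded u]
  have "{i \<in> {1..n}. G (2 * (i - 1)) * G (2 * i) < 0} = flips"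
    unfolding G flips_def ..
  then show "finite {x. u x = 0}" "card {x. u x = 0} \<le> card flips"
    "\<And>x. u x = 0 \<Longrightarrow> crosses_zero_at u x"
    using zeros D_nonzero by (simp_all add: G)
qed

section \<open>The bound on the number of crossings\<close>

lemma ex_initial_segment:
  fixes J :: "'a::linorder set"
  assumes "finite J" "m \<le> card J"
  shows "\<exists>I \<subseteq> J. card I = m \<and> (\<forall>x \<in> I. \<forall>y \<in> J. y < x \<longrightarrow> y \<in> I)"
  using assms
proof (induction J arbitrary: m rule: finite_linorder_max_induct)
  case (insert b A)
  show ?case
  proof (cases "m \<le> card A")
    case True
    then obtain I where "I \<subseteq> A" "card I = m" "\<forall>x \<in> I. \<forall>y \<in> A. y < x \<longrightarrow> y \<in> I"
      using insert.IH by blast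
    moreover from this have "\<forall>x \<in> I. \<forall>y \<in> insert b A. y < x \<longrightarrow> y \<in> I"
      using insert.hyps(2) by (metis insertE less_asym subsetD)
    ultimately show ?thesis by blast
  next
    case False
    then have "m = card (insert b A)" using insert.prems insert.hyps by auto
    then show ?thesis by blast
  qed
qed simp

text \<open>Outside \<open>S\<close> the entry \<open>c x\<close> is 1 or -1, so a nonzero
  \<open>d x - c x\<close> has the sign of \<open>- c x\<close>; outside \<open>T\<close> it has the
  sign of \<open>d x\<close>. The same set \<open>J\<close> therefore alternates against
  \<open>S\<close> with \<open>\<eta>\<close> and against \<open>T\<close> with
  \<open>- \<eta>\<close>.\<close>

lemma card_flips_le:
  assumes "signotope {1..n} k X" and "sign_vector_pair n c d"
    and S: "S \<subseteq> {1..n}" "card S = k + 1" and T: "T \<subseteq> {1..n}" "card T = k + 1"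
    and c: "\<And>j. j \<in> {1..n} \<Longrightarrow>
      c j = (if j \<in> S then 0 else - real_of_int ((-1) ^ card {s \<in> S. j < s} * X (insert j S)))"
    and d: "\<And>j. j \<in> {1..n} \<Longrightarrow>
      d j = (if j \<in> T then 0 else - real_of_int ((-1) ^ card {s \<in> T. j < s} * X (insert j T)))"
  shows "card (sign_vector_pair.flips n c d) \<le> k"
proof (rule ccontr)
  interpret signotope "{1..n}" k X by fact
  interpret sign_vector_pair n c d by fact
  assume "\<not> card flips \<le> k"
  moreover have flips: "finite flips" "flips \<subseteq> {1..n}" by (auto simp: flips_def)
  ultimately have "k + 2 \<le> card (insert first flips)" using first_notin_flips by simp
  \<comment> \<open>The set is cut down to k + 2 elements. An initial segment keeps the number of
    smaller elements at each \<open>j\<close>, and with it the alternating signs.\<close>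
  then obtain J where J: "J \<subseteq> insert first flips" "card J = k + 2"
    and closed: "\<And>x y. x \<in> J \<Longrightarrow> y \<in> insert first flips \<Longrightarrow> y < x \<Longrightarrow> y \<in> J"
    using ex_initial_segment[of "insert first flips" "k + 2"] flips by blast
  have Jn: "J \<subseteq> {1..n}" using J flips first by auto
  have alt: "(-1) ^ card {z \<in> J. z < j} * (d j - c j) * D 0 > 0"
    if "j \<in> J" "\<not> (c j = 0 \<and> d j = 0)" for j
  proof -
    have "{z \<in> J. z < j} = {z \<in> insert first flips. z < j}" using J closed that by blast
    then show ?thesis using flips_alternate[of j] that J by auto
  qed
  have unit: "(-1) ^ card {s \<in> U. j < s} * X (insert j U) \<in> {1, -1}"
    if "U \<subseteq> {1..n}" "card U = k + 1" "j \<in> {1..n} - U" for U j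
  proof -
    have "finite U" using that(1) finite_subset by blast
    then have "X (insert j U) = 1 \<or> X (insert j U) = -1" using that sign_cases[of "insert j U"] by simp
    then show ?thesis by (cases "even (card {s \<in> U. j < s})") auto
  qed
  define \<eta> :: int where "\<eta> = (if D 0 > 0 then 1 else -1)"
  have "X J = (-1) ^ (k + 1) * \<eta>"
  proof (rule alternating_sign[OF Jn J(2) S], rule ballI)
    fix x assume x: "x \<in> J - S"
    then have xn: "x \<in> {1..n}" using Jn by auto
    obtain v :: int where v: "(-1) ^ card {s \<in> S. x < s} * X (insert x S) = v" "v = 1 \<or> v = -1"
      using unit[OF S, of x] x xn by auto
    moreover have "c x = - real_of_int v" using c[OF xn] x v(1) by simp
    ultimately show "(-1) ^ card {s \<in> S. x < s} * X (insert x S) = (-1) ^ card {y \<in> J. y < x} * \<eta>"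
      unfolding v(1) using alt[of x] x
      by (cases rule: sign_vectorE[OF sv(2), of x]; cases "even (card {y \<in> J. y < x})")
        (auto simp: \<eta>_def)
  qed
  moreover have "X J = (-1) ^ (k + 1) * - \<eta>"
  proof (rule alternating_sign[OF Jn J(2) T], rule ballI)
    fix x assume x: "x \<in> J - T"
    then have xn: "x \<in> {1..n}" using Jn by auto
    obtain v :: int where v: "(-1) ^ card {s \<in> T. x < s} * X (insert x T) = v" "v = 1 \<or> v = -1"
      using unit[OF T, of x] x xn by auto
    moreover have "d x = - real_of_int v" using d[OF xn] x v(1) by simp
    ultimately show "(-1) ^ card {s \<in> T. x < s} * X (insert x T) = (-1) ^ card {y \<in> J. y < x} * - \<eta>"
      unfolding v(1) using alt[of x] x D_nonzero[of 0]
      by (cases rule: sign_vectorE[OF sv(1), of x]; cases "even (card {y \<in> J. y < x})")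
        (auto simp: \<eta>_def)
  qed
  ultimately show False by (auto simp: \<eta>_def split: if_splits)
qed

section \<open>Alternating maps\<close>

lemma alternating_on_swap_adjacent:
  assumes "alternating_on E r f" "us @ a # b # vs \<in> tuples E r"
  shows "f (us @ b # a # vs) = - f (us @ a # b # vs)"
proof -
  let ?xs = "us @ a # b # vs" and ?i = "length us"
  let ?\<sigma> = "transpose ?i (Suc ?i)"
  have r: "r = length ?xs" using assms(2) by (simp add: tuples_def)
  have perm: "?\<sigma> permutes {..<r}" using r by (intro permutes_swap_id) auto
  have "permute_list ?\<sigma> ?xs = us @ b # a # vs"
  proof (rule nth_equalityI)
    fix i assume "i < length (permute_list ?\<sigma> ?xs)"
    then have "i < length ?xs" by simp
    then have "permute_list ?\<sigma> ?xs ! i = ?xs ! ?\<sigma> i"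
      using permute_list_nth[of ?\<sigma> ?xs i] perm r by simp
    then show "permute_list ?\<sigma> ?xs ! i = (us @ b # a # vs) ! i"
      by (auto simp: transpose_def nth_append nth_Cons' not_less)
  qed simp
  moreover have "sign ?\<sigma> = -1" by (simp add: sign_swap_id)
  ultimately show ?thesis using assms perm by (auto simp: alternating_on_def dest!: bspec)
qed

lemma alternating_on_move_last:
  assumes "alternating_on E r f" "us @ a # vs \<in> tuples E r"
  shows "f (us @ vs @ [a]) = (-1) ^ length vs * f (us @ a # vs)"
  using assms(2)
proof (induction vs arbitrary: us)
  case (Cons b vs)
  then have "(us @ [b]) @ a # vs \<in> tuples E r" by (auto simp: tuples_def)
  then have "f (us @ b # vs @ [a]) = (-1) ^ length vs * f (us @ b # a # vs)"
    using Cons.IH by fastforce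
  then show ?case using alternating_on_swap_adjacent[OF assms(1) Cons.prems] by simp
qed simp

lemma alternating_on_not_distinct:
  fixes f :: "'a list \<Rightarrow> int"
  assumes "alternating_on E r f" "xs \<in> tuples E r" "\<not> distinct xs"
  shows "f xs = 0"
proof -
  obtain i j where ij: "i < length xs" "j < length xs" "i \<noteq> j" "xs ! i = xs ! j"
    using assms(3) by (auto simp: distinct_conv_nth)
  have r: "r = length xs" using assms(2) by (simp add: tuples_def)
  have perm: "transpose i j permutes {..<r}" using r ij by (intro permutes_swap_id) auto
  have "permute_list (transpose i j) xs = xs"
  proof (rule nth_equalityI)
    fix l assume "l < length (permute_list (transpose i j) xs)"
    then have "permute_list (transpose i j) xs ! l = xs ! transpose i j l"
      using permute_list_nth[of "transpose i j" xs l] perm r by simp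
    then show "permute_list (transpose i j) xs ! l = xs ! l"
      using ij by (auto simp: transpose_def)
  qed simp
  moreover have "sign (transpose i j) = -1" using ij by (simp add: sign_swap_id)
  ultimately have "f xs = - f xs" using assms(1,2) perm unfolding alternating_on_def
    by (metis mult_minus1)
  then show ?thesis by simp
qed

lemma alternating_on_eqI:
  fixes f g :: "'a::linorder list \<Rightarrow> int"
  assumes f: "alternating_on E r f" and g: "alternating_on E r g"
    and eq: "\<And>xs. xs \<in> increasing_tuples E r \<Longrightarrow> f xs = g xs" and xs: "xs \<in> tuples E r"
  shows "f xs = g xs"
proof (cases "distinct xs")
  case True
  have inc: "sort xs \<in> increasing_tuples E r"
    using xs True by (auto simp: increasing_tuples_def tuples_def strict_sorted_iff)
  obtain \<sigma> where \<sigma>: "\<sigma> permutes {..<length (sort xs)}" "permute_list \<sigma> (sort xs) = xs"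
    by (rule mset_eq_permutation[of xs "sort xs"]) simp_all
  have "sort xs \<in> tuples E r" "\<sigma> permutes {..<r}"
    using inc \<sigma>(1) by (auto simp: increasing_tuples_def tuples_def)
  then show ?thesis using f g eq[OF inc] \<sigma>(2) unfolding alternating_on_def by metis
next
  case False
  then show ?thesis using alternating_on_not_distinct f g xs by metis
qed

lemma sorted_list_of_set_in_increasing_tuples:
  assumes "finite S" "S \<subseteq> E" "card S = r"
  shows "sorted_list_of_set S \<in> increasing_tuples E r"
  using assms by (simp add: increasing_tuples_def tuples_def)

lemma increasing_tuplesE:
  assumes "xs \<in> increasing_tuples E r"
  shows "xs = sorted_list_of_set (set xs)" "set xs \<subseteq> E" "card (set xs) = r"
proof -
  have "sorted xs" "distinct xs" "length xs = r" "set xs \<subseteq> E"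
    using assms by (auto simp: increasing_tuples_def tuples_def strict_sorted_iff)
  then show "xs = sorted_list_of_set (set xs)" "set xs \<subseteq> E" "card (set xs) = r"
    by (auto simp: distinct_card sorted_list_of_set.idem_if_sorted_distinct)
qed

text \<open>Moving \<open>j\<close> from its sorted place to the end takes one adjacent swap for
  each larger element of \<open>S\<close>. This is where the sign in \<open>alternating_sign\<close>
  comes from.\<close>

lemma alternating_on_append_last:
  fixes f :: "'a::linorder list \<Rightarrow> int"
  assumes f: "alternating_on E r f" and S: "finite S" "insert j S \<subseteq> E" "j \<notin> S" "r = Suc (card S)"
  shows "f (sorted_list_of_set S @ [j]) =
    (-1) ^ card {s \<in> S. j < s} * f (sorted_list_of_set (insert j S))"
proof -
  define us vs where "us = sorted_list_of_set {s \<in> S. s < j}" and "vs = sorted_list_of_set {s \<in> S. j < s}"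
  have set: "set us = {s \<in> S. s < j}" "set vs = {s \<in> S. j < s}" using S by (simp_all add: us_def vs_def)
  have srt: "sorted us" "distinct us" "sorted vs" "distinct vs" by (simp_all add: us_def vs_def)
  have "sorted_list_of_set (set (us @ vs)) = us @ vs"
    by (rule sorted_list_of_set.idem_if_sorted_distinct) (use srt set in \<open>auto simp: sorted_append\<close>)
  moreover have "s < j \<or> j < s" if "s \<in> S" for s using S(3) that by (metis neqE)
  then have "set (us @ vs) = S" using set by auto
  ultimately have 1: "sorted_list_of_set S = us @ vs" by simp
  have "sorted_list_of_set (set (us @ j # vs)) = us @ j # vs"
    by (rule sorted_list_of_set.idem_if_sorted_distinct)
      (use srt set in \<open>auto simp: sorted_append less_imp_le dest: less_trans\<close>)
  moreover have "set (us @ j # vs) = insert j S" using \<open>set (us @ vs) = S\<close> by auto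
  ultimately have 2: "sorted_list_of_set (insert j S) = us @ j # vs" by (simp only:)
  have "length (us @ vs) = card S" using S 1 by (metis length_sorted_list_of_set)
  then have "us @ j # vs \<in> tuples E r" using S set by (auto simp: tuples_def)
  moreover have "length vs = card {s \<in> S. j < s}" by (simp add: vs_def)
  ultimately show ?thesis using alternating_on_move_last[OF f, of us j vs] 1 2 by simp
qed

text \<open>Needed because \<open>chi_PP\<close> is a definite description. \<open>is_chi_PP\<close>
  prescribes values only for points off the curve, hence \<open>off\<close>. An increasing tuple
  splits into a curve and its last entry; the alternating law settles the other tuples.\<close>

lemma is_chi_PP_unique:
  assumes f: "is_chi_PP k n p L f" and g: "is_chi_PP k n p L g"
    and off: "\<And>xs j. xs \<in> increasing_tuples {1..n} (k + 1) \<Longrightarrow> j \<in> {1..n} - set xs \<Longrightarrow>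
      p j \<in> above (curve_through L (p ` set xs)) \<union> below (curve_through L (p ` set xs))"
  shows "f = g"
proof
  fix xs
  have inc: "f ys = g ys" if ys: "ys \<in> increasing_tuples {1..n} (k + 2)" for ys
  proof -
    have "ys \<noteq> []" using ys by (auto simp: increasing_tuples_def tuples_def)
    then obtain zs j where zs: "ys = zs @ [j]" by (metis rev_exhaust)
    have "zs \<in> increasing_tuples {1..n} (k + 1)" "j \<in> {1..n} - set zs"
      using ys by (auto simp: increasing_tuples_def tuples_def zs sorted_wrt_append)
    then show ?thesis using f g off[of zs j] unfolding is_chi_PP_def zs by (metis UnE)
  qed
  show "f xs = g xs"
  proof (cases "xs \<in> tuples {1..n} (k + 2)")
    case True
    then show ?thesis using alternating_on_eqI[OF _ _ inc] f g by (auto simp: is_chi_PP_def)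
  next
    case False
    then show ?thesis using f g by (simp add: is_chi_PP_def)
  qed
qed

section \<open>The pseudoconfiguration\<close>

lemma height_graph: "height {(x, f x) | x. True} = f"
  by (simp add: height_def fun_eq_iff)

lemma transversal_at_graphs:
  assumes "crosses_zero_at (\<lambda>x. g x - f x) (fst q)"
  shows "transversal_at {(x, f x) | x. True} {(x, g x) | x. True} q"
  using assms unfolding transversal_at_def crosses_upwards_at_def crosses_zero_at_def height_graph
  by auto

text \<open>The points can all lie on the x-axis, since the curves bend around them. Odd abscissas
  match \<open>heights\<close>.\<close>

definition point :: "nat \<Rightarrow> real \<times> real" where "point j = (real (2 * j - 1), 0)"

text \<open>The minus sign changes the point of view: \<open>chi\<close> tells where the point lies
  relative to the curve, \<open>side\<close> where the curve lies relative to the point.\<close>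

definition side :: "(nat list \<Rightarrow> int) \<Rightarrow> nat set \<Rightarrow> nat \<Rightarrow> real" where
  "side chi S j = (if j \<in> S then 0 else - real_of_int (chi (sorted_list_of_set S @ [j])))"

definition curve_of :: "nat \<Rightarrow> (nat list \<Rightarrow> int) \<Rightarrow> nat set \<Rightarrow> (real \<times> real) set" where
  "curve_of n chi S = {(x, curve n (side chi S) x) | x. True}"

lemma om_eq_iff: "om E f = om E' g \<longleftrightarrow> E = E' \<and> (f = g \<or> f = - g)"
  by (auto simp: doubleton_eq_iff)

section \<open>From the chirotope to its curves\<close>

locale degree_chirotope =
  fixes k n :: nat and chi :: "nat list \<Rightarrow> int"
  assumes alternating: "alternating_on {1..n} (k + 2) chi"
    and zero_outside: "xs \<notin> tuples {1..n} (k + 2) \<Longrightarrow> chi xs = 0"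
    and unit: "xs \<in> increasing_tuples {1..n} (k + 2) \<Longrightarrow> chi xs \<in> {1, -1}"
    and degree: "xs \<in> increasing_tuples {1..n} (k + 3) \<Longrightarrow> a \<in> set xs \<Longrightarrow> b \<in> set xs \<Longrightarrow> c \<in> set xs \<Longrightarrow>
      a < b \<Longrightarrow> b < c \<Longrightarrow> chi (remove1 c xs) = - chi (remove1 b xs) \<Longrightarrow>
      chi (remove1 a xs) = chi (remove1 b xs)"

text \<open>The two existential quantifiers in the definition may pick different representatives
  \<open>f\<close> and \<open>g\<close>, each equal to \<open>chi\<close> up to sign. All conditions
  survive negation, so they pass to \<open>chi\<close> itself.\<close>

lemma degree_chirotope:
  assumes "degree_uniform_oriented_matroid k (om {1..n} chi)"
  shows "degree_chirotope k n chi"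
proof -
  obtain f where f: "chi = f \<or> chi = - f" "chirotope {1..n} (k + 2) f"
      "\<forall>xs \<in> increasing_tuples {1..n} (k + 2). f xs \<noteq> 0"
    using assms unfolding degree_uniform_oriented_matroid_def uniform_oriented_matroid_def om_eq_iff
    by blast
  have alt: "alternating_on {1..n} (k + 2) f" using f by (simp add: chirotope_def)
  obtain g where g: "chi = g \<or> chi = - g"
      "\<forall>xs \<in> increasing_tuples {1..n} (k + 3). \<forall>a \<in> set xs. \<forall>b \<in> set xs. \<forall>c \<in> set xs.
          a < b \<longrightarrow> b < c \<longrightarrow> g (remove1 c xs) = - g (remove1 b xs) \<longrightarrow>
          g (remove1 a xs) = g (remove1 b xs)"
    using assms unfolding degree_uniform_oriented_matroid_def om_eq_iff by blast
  show ?thesis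
  proof
    show "alternating_on {1..n} (k + 2) chi"
      using f(1) alt by (auto simp: alternating_on_def)
    show "chi xs = 0" if "xs \<notin> tuples {1..n} (k + 2)" for xs
      using f(1,2) that by (auto simp: chirotope_def)
    show "chi xs \<in> {1, -1}" if "xs \<in> increasing_tuples {1..n} (k + 2)" for xs
    proof -
      have "f xs \<in> {1, -1, 0}" "f xs \<noteq> 0"
        using f(2,3) that by (auto simp: chirotope_def increasing_tuples_def)
      then show ?thesis using f(1) by auto
    qed
    show "chi (remove1 a xs) = chi (remove1 b xs)"
      if "xs \<in> increasing_tuples {1..n} (k + 3)" "a \<in> set xs" "b \<in> set xs" "c \<in> set xs"
        "a < b" "b < c" "chi (remove1 c xs) = - chi (remove1 b xs)" for xs a b c
    proof -
      have "g (remove1 c xs) = - g (remove1 b xs)" using g(1) that(7) by auto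
      then have "g (remove1 a xs) = g (remove1 b xs)" using g(2) that by blast
      then show ?thesis using g(1) by auto
    qed
  qed
qed

context degree_chirotope
begin

lemma signotope: "signotope {1..n} k (\<lambda>K. chi (sorted_list_of_set K))"
proof
  fix K :: "nat set" assume K: "K \<subseteq> {1..n}" "card K = k + 2"
  then have "finite K" using finite_subset by blast
  then show "chi (sorted_list_of_set K) = 1 \<or> chi (sorted_list_of_set K) = -1"
    using unit sorted_list_of_set_in_increasing_tuples K by blast
next
  fix K a b c assume K: "K \<subseteq> {1..n}" "card K = k + 3" and "a \<in> K" "b \<in> K" "c \<in> K" "a < b" "b < c"
    "chi (sorted_list_of_set (K - {c})) = - chi (sorted_list_of_set (K - {b}))"
  moreover have "finite K" using K finite_subset by blast
  ultimately show "chi (sorted_list_of_set (K - {a})) = chi (sorted_list_of_set (K - {b}))"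
    using degree[OF sorted_list_of_set_in_increasing_tuples[of K], of a b c]
    by (simp add: sorted_list_of_set_remove)
qed simp

definition bases :: "nat set set" where "bases = {S. S \<subseteq> {1..n} \<and> card S = k + 1}"

lemma basesD: "S \<in> bases \<Longrightarrow> S \<subseteq> {1..n} \<and> card S = k + 1 \<and> finite S"
  unfolding bases_def using finite_subset by blast

lemma side_eq:
  assumes "S \<in> bases" "j \<in> {1..n}"
  shows "side chi S j = (if j \<in> S then 0 else
    - real_of_int ((-1) ^ card {s \<in> S. j < s} * chi (sorted_list_of_set (insert j S))))"
  using alternating_on_append_last[OF alternating, of S j] basesD[OF assms(1)] assms(2)
  by (auto simp: side_def)

lemma side_unit:
  assumes "S \<in> bases" "j \<in> {1..n} - S"
  shows "chi (sorted_list_of_set S @ [j]) \<in> {1, -1}"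
proof -
  have "sorted_list_of_set (insert j S) \<in> increasing_tuples {1..n} (k + 2)"
    using basesD[OF assms(1)] assms(2) by (intro sorted_list_of_set_in_increasing_tuples) auto
  then have "chi (sorted_list_of_set (insert j S)) \<in> {1, -1}" by (rule unit)
  then show ?thesis
    using alternating_on_append_last[OF alternating, of S j] basesD[OF assms(1)] assms(2)
    by (cases "even (card {s \<in> S. j < s})") auto
qed

lemma side_eq_0_iff: "S \<in> bases \<Longrightarrow> j \<in> {1..n} \<Longrightarrow> side chi S j = 0 \<longleftrightarrow> j \<in> S"
  using side_unit[of S j] by (auto simp: side_def)

lemma sign_vector_side:
  assumes "S \<in> bases"
  shows "sign_vector (side chi S)"
  unfolding sign_vector_def
proof
  fix j
  \<comment> \<open>\<open>sign_vector\<close> speaks about every natural number; off the ground set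
    the dummy value 0 of \<open>chi\<close> is what makes it true.\<close>
  have "chi (sorted_list_of_set S @ [j]) = 0" if "j \<notin> {1..n}"
    using that by (intro zero_outside) (auto simp: tuples_def)
  then show "side chi S j \<in> {-1, 0, 1}"
    using side_unit[OF assms, of j] by (cases "j \<in> {1..n}") (auto simp: side_def)
qed

lemma height_curve_of_eq: "height (curve_of n chi S) = curve n (side chi S)"
  unfolding curve_of_def by (rule height_graph)

lemma height_curve_of:
  assumes "S \<in> bases" "j \<in> {1..n}"
  shows "j \<in> S \<Longrightarrow> height (curve_of n chi S) (fst (point j)) = 0"
    "j \<notin> S \<Longrightarrow> chi (sorted_list_of_set S @ [j]) = 1 \<Longrightarrow> height (curve_of n chi S) (fst (point j)) < 0"
    "j \<notin> S \<Longrightarrow> chi (sorted_list_of_set S @ [j]) = -1 \<Longrightarrow> height (curve_of n chi S) (fst (point j)) > 0"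
  using curve_at_point[OF sign_vector_side[OF assms(1)] assms(2)]
  by (simp_all add: side_def height_curve_of_eq point_def)

lemma point_in_curve_of_iff:
  assumes "S \<in> bases" "j \<in> {1..n}"
  shows "point j \<in> curve_of n chi S \<longleftrightarrow> j \<in> S"
proof -
  have "point j \<in> curve_of n chi S \<longleftrightarrow> height (curve_of n chi S) (fst (point j)) = 0"
    unfolding height_curve_of_eq by (auto simp: curve_of_def point_def)
  then show ?thesis using height_curve_of[OF assms] side_unit[OF assms(1), of j] assms(2) by fastforce
qed

lemma inj_on_point: "inj_on point {1..n}"
  by (auto simp: inj_on_def point_def)

lemma points_on_curve_of: "S \<in> bases \<Longrightarrow> point ` {1..n} \<inter> curve_of n chi S = point ` S"
  using point_in_curve_of_iff[of S] basesD[of S] by (auto simp: subset_iff)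

lemma card_point_image: "S \<subseteq> {1..n} \<Longrightarrow> card (point ` S) = card S"
  by (rule card_image[OF inj_on_subset[OF inj_on_point]])

lemma point_image_subset_curve_of_iff:
  assumes "S \<in> bases" "T \<in> bases"
  shows "point ` S \<subseteq> curve_of n chi T \<longleftrightarrow> S = T"
proof
  assume "point ` S \<subseteq> curve_of n chi T"
  then have "j \<in> T" if "j \<in> S" for j
    using point_in_curve_of_iff[OF assms(2), of j] basesD[OF assms(1)] that by blast
  then have "S \<subseteq> T" by blast
  then show "S = T" using basesD[OF assms(1)] basesD[OF assms(2)] card_subset_eq[of T S] by metis
next
  assume "S = T"
  then show "point ` S \<subseteq> curve_of n chi T" using points_on_curve_of[OF assms(1)] by blast
qed

lemma curve_through_eq:
  assumes "S \<in> bases"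
  shows "curve_through (curve_of n chi ` bases) (point ` S) = curve_of n chi S"
  unfolding curve_through_def
  by (rule the_equality) (use assms in \<open>auto simp: point_image_subset_curve_of_iff\<close>)

lemma curves_intersect:
  assumes S: "S \<in> bases" and T: "T \<in> bases" and "S \<noteq> T"
  defines "I \<equiv> curve_of n chi S \<inter> curve_of n chi T"
  shows "finite I" "card I \<le> k" "\<forall>q \<in> I. transversal_at (curve_of n chi S) (curve_of n chi T) q"
proof -
  let ?c = "side chi S" and ?d = "side chi T"
  note bS = basesD[OF S] and bT = basesD[OF T]
  \<comment> \<open>Sets of equal size: some \<open>j\<close> lies in \<open>S\<close> only, and
    there the entry of \<open>S\<close> is 0 while that of \<open>T\<close> is not.\<close>
  have "\<not> S \<subseteq> T" using bS bT \<open>S \<noteq> T\<close> by (metis card_subset_eq)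
  then obtain j where "j \<in> S" "j \<notin> T" by blast
  then have "\<exists>j \<in> {1..n}. ?c j \<noteq> ?d j" using side_eq_0_iff[OF S] side_eq_0_iff[OF T] bS
    by (metis subsetD)
  then interpret sign_vector_pair n ?c ?d
    using sign_vector_side S T by unfold_locales
  have "card flips \<le> k"
    using bS bT side_eq[OF S] side_eq[OF T]
    by (intro card_flips_le[OF signotope sign_vector_pair_axioms]) auto
  moreover have I: "I = (\<lambda>x. (x, curve n ?c x)) ` {x. curve n ?d x - curve n ?c x = 0}"
    by (auto simp: I_def curve_of_def)
  ultimately show "finite I" "card I \<le> k"
    using curve_crossings(1,2) card_image_le[OF curve_crossings(1)] by (auto intro: order_trans)
  show "\<forall>q \<in> I. transversal_at (curve_of n chi S) (curve_of n chi T) q"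
  proof
    fix q assume "q \<in> I"
    then have "curve n ?d (fst q) - curve n ?c (fst q) = 0" unfolding I by auto
    then show "transversal_at (curve_of n chi S) (curve_of n chi T) q"
      unfolding curve_of_def by (intro transversal_at_graphs curve_crossings(3))
  qed
qed

lemma pseudoconfiguration: "pseudoconfiguration k n point (curve_of n chi ` bases)"
  unfolding pseudoconfiguration_def
proof (intro conjI ballI allI impI)
  show "strict_mono_on {1..n} (\<lambda>i. fst (point i))"
    by (auto simp: strict_mono_on_def point_def)
  show "x_monotone_curve l" if "l \<in> curve_of n chi ` bases" for l
    using that continuous_pl by (auto simp: x_monotone_curve_def curve_of_def curve_def)
  show "k + 1 \<le> card (point ` {1..n} \<inter> l)" if "l \<in> curve_of n chi ` bases" for l
    using that points_on_curve_of card_point_image basesD by auto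
  show "\<exists>!l. l \<in> curve_of n chi ` bases \<and> Q \<subseteq> l" if "Q \<subseteq> point ` {1..n}" "card Q = k + 1" for Q
  proof -
    obtain S where S: "S \<subseteq> {1..n}" "Q = point ` S" using \<open>Q \<subseteq> point ` {1..n}\<close> subset_imageE by metis
    then have "S \<in> bases" using that card_point_image by (simp add: bases_def)
    then show ?thesis unfolding S(2)
      by (intro ex1I[of _ "curve_of n chi S"]) (auto simp: point_image_subset_curve_of_iff)
  qed
  fix l m assume "l \<in> curve_of n chi ` bases" "m \<in> curve_of n chi ` bases" "l \<noteq> m"
  then obtain S T where "S \<in> bases" "T \<in> bases" "S \<noteq> T" "l = curve_of n chi S" "m = curve_of n chi T"
    by blast
  then show "finite (l \<inter> m)" "card (l \<inter> m) \<le> k" "\<And>q. q \<in> l \<inter> m \<Longrightarrow> transversal_at l m q"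
    using curves_intersect[of S T] by simp_all
qed

lemma is_chi_PP_and_off:
  shows "is_chi_PP k n point (curve_of n chi ` bases) chi"
    and "xs \<in> increasing_tuples {1..n} (k + 1) \<Longrightarrow> j \<in> {1..n} - set xs \<Longrightarrow>
      point j \<in> above (curve_through (curve_of n chi ` bases) (point ` set xs)) \<union>
        below (curve_through (curve_of n chi ` bases) (point ` set xs))"
proof -
  let ?C = "\<lambda>xs. curve_through (curve_of n chi ` bases) (point ` set xs)"
  have main: "chi (xs @ [j]) = 1 \<and> point j \<in> above (?C xs) \<and> point j \<notin> below (?C xs) \<or>
      chi (xs @ [j]) = -1 \<and> point j \<in> below (?C xs) \<and> point j \<notin> above (?C xs)"
    if xs: "xs \<in> increasing_tuples {1..n} (k + 1)" and j: "j \<in> {1..n} - set xs" for xs j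
  proof -
    note inc = increasing_tuplesE[OF xs]
    then have S: "set xs \<in> bases" by (simp add: bases_def)
    show ?thesis
      using side_unit[OF S j] height_curve_of(2,3)[OF S, of j] j
      unfolding curve_through_eq[OF S] inc(1)[symmetric]
      by (auto simp: above_def below_def point_def)
  qed
  show "is_chi_PP k n point (curve_of n chi ` bases) chi"
    unfolding is_chi_PP_def
  proof (intro conjI ballI impI allI)
    show "chi (xs @ [j]) = 1"
      if "xs \<in> increasing_tuples {1..n} (k + 1)" "j \<in> {1..n} - set xs" "point j \<in> above (?C xs)" for xs j
      using main[OF that(1,2)] that(3) by blast
    show "chi (xs @ [j]) = - 1"
      if "xs \<in> increasing_tuples {1..n} (k + 1)" "j \<in> {1..n} - set xs" "point j \<in> below (?C xs)" for xs j
      using main[OF that(1,2)] that(3) by blast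
  qed (use alternating zero_outside alternating_on_not_distinct[OF alternating] in blast)+
  show "point j \<in> above (?C xs) \<union> below (?C xs)"
    if "xs \<in> increasing_tuples {1..n} (k + 1)" "j \<in> {1..n} - set xs"
    using main[OF that] by blast
qed

text \<open>The orientation built into \<open>side\<close> gives equality of maps here, not only
  equality up to sign.\<close>

lemma chi_PP_eq: "chi_PP k n point (curve_of n chi ` bases) = chi"
  unfolding chi_PP_def
proof (rule the_equality)
  show "is_chi_PP k n point (curve_of n chi ` bases) chi" by (rule is_chi_PP_and_off)
  show "f = chi" if "is_chi_PP k n point (curve_of n chi ` bases) f" for f
    using that is_chi_PP_and_off by (rule is_chi_PP_unique)
qed

lemma general_position: "general_position k n point (curve_of n chi ` bases)"
  using points_on_curve_of card_point_image basesD by (auto simp: general_position_def)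

end

theorem theorem4p8:
  fixes k n :: nat and chi :: "nat list \<Rightarrow> int"
  assumes "k \<ge> 1" and "n \<ge> 1"
    and "degree_uniform_oriented_matroid k (om {1..n} chi)"
  shows "\<exists>p L. pseudoconfiguration k n p L \<and> general_position k n p L \<and>
           om {1..n} chi = M_PP k n p L"
proof -
  interpret degree_chirotope k n chi by (rule degree_chirotope[OF assms(3)])
  show ?thesis unfolding M_PP_def
    using pseudoconfiguration general_position chi_PP_eq by metis
qed

end
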